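(* Fix $R>0$. For $\kappa>-\frac1{R^2}$, let $g_\kappa$ be the Riemannian metric on $\mathbb{D}_R=\{(x,y)\in\mathbb{R}^2: x^2+y^2\le R^2\}$ given in polar coordinates by $(1+\kappa r^2)^2dr^2+r^2d\theta^2$. If $|\kappa|R^2<1$, then $(\mathbb{D}_R,g_\kappa)$ is simple. If $\kappa\ge\frac{1}{R^2}$, then $(\mathbb{D}_R,g_\kappa)$ has conjugate points.
   Context: A compact oriented Riemannian surface with boundary is called *simple* if its boundary is strictly convex (positive definite second fundamental form), it is non-trapping (the exit times of all geodesics are uniformly bounded), and it has no conjugate points. Two points $p=\gamma(t_0)$, $q=\gamma(t_1)$, $t_0<t_1$, on a unit speed geodesic $\gamma$ are conjugate along $\gamma$ if there is a nontrivial solution $j$ of $\ddot j+K(\gamma(t))j=0$ with $j(t_0)=j(t_1)=0$, where $K$ is the Gaussian curvature. Points of $\partial\mathbb{D}_R$ are allowed as conjugate points. *)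

theory Defs
  imports "HOL-Analysis.Analysis"
begin

subsection \<open>Riemannian metrics in planar coordinates\<close>

text \<open>
  A metric is represented by its Gram matrix field in the Cartesian coordinates of the plane.
  A metric on a closed region \<open>M\<close> is one that is smooth on an open neighbourhood of \<open>M\<close>, so that
  ordinary (two-sided) derivatives may be taken at boundary points; if \<open>M\<close> is the closure of its
  interior, these are determined by the values on \<open>M\<close>.
\<close>

type_synonym metric = "real^2 \<Rightarrow> real^2^2"

definition partial :: "2 \<Rightarrow> (real^2 \<Rightarrow> real) \<Rightarrow> real^2 \<Rightarrow> real" where
  "partial i f p = frechet_derivative f (at p) (axis i 1)"

primrec Ck_on :: "nat \<Rightarrow> (real^2) set \<Rightarrow> (real^2 \<Rightarrow> real) \<Rightarrow> bool" where
  "Ck_on 0 U f \<longleftrightarrow> continuous_on U f"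
| "Ck_on (Suc k) U f \<longleftrightarrow> (\<forall>p\<in>U. f differentiable (at p)) \<and> (\<forall>i. Ck_on k U (partial i f))"

definition smooth_on :: "(real^2) set \<Rightarrow> (real^2 \<Rightarrow> real) \<Rightarrow> bool" where
  "smooth_on U f \<longleftrightarrow> (\<forall>k. Ck_on k U f)"

definition metric_inner :: "metric \<Rightarrow> real^2 \<Rightarrow> real^2 \<Rightarrow> real^2 \<Rightarrow> real" where
  "metric_inner g p v w = v \<bullet> (g p *v w)"

definition riemannian_metric_on :: "(real^2) set \<Rightarrow> metric \<Rightarrow> bool" where
  "riemannian_metric_on M g \<longleftrightarrow>
     (\<exists>U. open U \<and> M \<subseteq> U \<and> (\<forall>i j. smooth_on U (\<lambda>p. g p $ i $ j))) \<and>
     (\<forall>p\<in>M. transpose (g p) = g p \<and> (\<forall>v. v \<noteq> 0 \<longrightarrow> metric_inner g p v v > 0))"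

definition christoffel :: "metric \<Rightarrow> 2 \<Rightarrow> 2 \<Rightarrow> 2 \<Rightarrow> real^2 \<Rightarrow> real" where
  "christoffel g k i j p =
     1/2 * (\<Sum>l\<in>UNIV. matrix_inv (g p) $ k $ l *
       (partial i (\<lambda>q. g q $ j $ l) p + partial j (\<lambda>q. g q $ i $ l) p
        - partial l (\<lambda>q. g q $ i $ j) p))"

definition christoffel_form :: "metric \<Rightarrow> real^2 \<Rightarrow> real^2 \<Rightarrow> real^2 \<Rightarrow> real^2" where
  "christoffel_form g p v w =
     (\<chi> k. \<Sum>i\<in>UNIV. \<Sum>j\<in>UNIV. christoffel g k i j p * v $ i * w $ j)"

text \<open>The covariant derivative of the vector field \<open>Y\<close> in the direction \<open>v\<close> at \<open>p\<close>.\<close>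

definition cov_deriv :: "metric \<Rightarrow> real^2 \<Rightarrow> real^2 \<Rightarrow> (real^2 \<Rightarrow> real^2) \<Rightarrow> real^2" where
  "cov_deriv g p v Y = frechet_derivative Y (at p) v + christoffel_form g p v (Y p)"

text \<open>
  \<open>riemann g l k i j\<close> is the component along \<open>\<partial>\<^sub>l\<close> of \<open>R(\<partial>\<^sub>i, \<partial>\<^sub>j) \<partial>\<^sub>k\<close>, with
  \<open>R(X,Y) = \<nabla>\<^sub>X \<nabla>\<^sub>Y - \<nabla>\<^sub>Y \<nabla>\<^sub>X - \<nabla>\<^bsub>[X,Y]\<^esub>\<close>; the Gaussian curvature
  is then \<open>\<langle>R(\<partial>\<^sub>1, \<partial>\<^sub>2) \<partial>\<^sub>2, \<partial>\<^sub>1\<rangle> / det g\<close>, positive for the round sphere.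
\<close>

definition riemann :: "metric \<Rightarrow> 2 \<Rightarrow> 2 \<Rightarrow> 2 \<Rightarrow> 2 \<Rightarrow> real^2 \<Rightarrow> real" where
  "riemann g l k i j p =
     partial i (christoffel g l j k) p - partial j (christoffel g l i k) p
     + (\<Sum>m\<in>UNIV. christoffel g m j k p * christoffel g l i m p
                  - christoffel g m i k p * christoffel g l j m p)"

definition gauss_curvature :: "metric \<Rightarrow> real^2 \<Rightarrow> real" where
  "gauss_curvature g p = (\<Sum>l\<in>UNIV. g p $ 1 $ l * riemann g l 2 1 2 p) / det (g p)"

subsection \<open>Geodesics, exit times and conjugate points\<close>

text \<open>The function \<open>u\<close> is the velocity of the curve \<open>\<gamma> : I \<rightarrow> M\<close>.\<close>

definition unit_speed_geodesic ::
    "(real^2) set \<Rightarrow> metric \<Rightarrow> real set \<Rightarrow> (real \<Rightarrow> real^2) \<Rightarrow> (real \<Rightarrow> real^2) \<Rightarrow> bool" where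
  "unit_speed_geodesic M g I \<gamma> u \<longleftrightarrow> is_interval I \<and>
     (\<forall>t\<in>I. \<gamma> t \<in> M \<and>
        (\<gamma> has_vector_derivative u t) (at t within I) \<and>
        (u has_vector_derivative - christoffel_form g (\<gamma> t) (u t) (u t)) (at t within I) \<and>
        metric_inner g (\<gamma> t) (u t) (u t) = 1)"

definition exit_time :: "(real^2) set \<Rightarrow> metric \<Rightarrow> real^2 \<Rightarrow> real^2 \<Rightarrow> ereal" where
  "exit_time M g p v =
     Sup {ereal T | T. T \<ge> 0 \<and>
            (\<exists>\<gamma> u. unit_speed_geodesic M g {0..T} \<gamma> u \<and> \<gamma> 0 = p \<and> u 0 = v)}"

definition non_trapping :: "(real^2) set \<Rightarrow> metric \<Rightarrow> bool" where
  "non_trapping M g \<longleftrightarrow>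
     (\<exists>L::real. \<forall>p\<in>M. \<forall>v. metric_inner g p v v = 1 \<longrightarrow> exit_time M g p v \<le> ereal L)"

definition jacobi_solution ::
    "metric \<Rightarrow> real set \<Rightarrow> (real \<Rightarrow> real^2) \<Rightarrow> (real \<Rightarrow> real) \<Rightarrow> bool" where
  "jacobi_solution g I \<gamma> j \<longleftrightarrow>
     (\<exists>j'. \<forall>t\<in>I. (j has_real_derivative j' t) (at t within I) \<and>
        (j' has_real_derivative - gauss_curvature g (\<gamma> t) * j t) (at t within I))"

definition conjugate_along ::
    "metric \<Rightarrow> real set \<Rightarrow> (real \<Rightarrow> real^2) \<Rightarrow> real \<Rightarrow> real \<Rightarrow> bool" where
  "conjugate_along g I \<gamma> t\<^sub>0 t\<^sub>1 \<longleftrightarrow>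
     (\<exists>j. jacobi_solution g I \<gamma> j \<and> (\<exists>t\<in>I. j t \<noteq> 0) \<and> j t\<^sub>0 = 0 \<and> j t\<^sub>1 = 0)"

definition has_conjugate_points :: "(real^2) set \<Rightarrow> metric \<Rightarrow> bool" where
  "has_conjugate_points M g \<longleftrightarrow>
     (\<exists>I \<gamma> u t\<^sub>0 t\<^sub>1. unit_speed_geodesic M g I \<gamma> u \<and> t\<^sub>0 \<in> I \<and> t\<^sub>1 \<in> I \<and> t\<^sub>0 < t\<^sub>1 \<and>
        conjugate_along g I \<gamma> t\<^sub>0 t\<^sub>1)"

subsection \<open>Simple metrics on a disc\<close>

abbreviation disc :: "real \<Rightarrow> (real^2) set" where
  "disc R \<equiv> cball 0 R"

text \<open>
  The vector \<open>g\<^sup>-\<^sup>1 p\<close> is the \<open>g\<close>-gradient of half the squared Euclidean norm, so the following field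
  consists, off the origin, of the inward \<open>g\<close>-unit normals to the circles centred at the origin.
  In the second fundamental form of the circle through \<open>p\<close> it is differentiated in
  tangential directions only.
\<close>

definition inward_normal :: "metric \<Rightarrow> real^2 \<Rightarrow> real^2" where
  "inward_normal g p =
     (let n = matrix_inv (g p) *v p in - (1 / sqrt (metric_inner g p n n)) *\<^sub>R n)"

definition second_fundamental_form :: "metric \<Rightarrow> real^2 \<Rightarrow> real^2 \<Rightarrow> real^2 \<Rightarrow> real" where
  "second_fundamental_form g p v w = - metric_inner g p (cov_deriv g p v (inward_normal g)) w"

definition strictly_convex_boundary :: "real \<Rightarrow> metric \<Rightarrow> bool" where
  "strictly_convex_boundary R g \<longleftrightarrow>
     (\<forall>p\<in>sphere 0 R. \<forall>v. p \<bullet> v = 0 \<and> v \<noteq> 0 \<longrightarrow> second_fundamental_form g p v v > 0)"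

definition simple_disc :: "real \<Rightarrow> metric \<Rightarrow> bool" where
  "simple_disc R g \<longleftrightarrow> riemannian_metric_on (disc R) g \<and> strictly_convex_boundary R g \<and>
     non_trapping (disc R) g \<and> \<not> has_conjugate_points (disc R) g"

subsection \<open>The metrics \<open>g\<^sub>\<kappa>\<close>\<close>

text \<open>
  Since \<open>r dr = x dx + y dy\<close> and \<open>dr\<^sup>2 + r\<^sup>2 d\<theta>\<^sup>2 = dx\<^sup>2 + dy\<^sup>2\<close>, the polar expression
  \<open>(1 + \<kappa>r\<^sup>2)\<^sup>2 dr\<^sup>2 + r\<^sup>2 d\<theta>\<^sup>2\<close> equals
  \<open>dx\<^sup>2 + dy\<^sup>2 + (2\<kappa> + \<kappa>\<^sup>2r\<^sup>2) (x dx + y dy)\<^sup>2\<close>, which is smooth across the origin.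
\<close>

definition g_kappa :: "real \<Rightarrow> metric" where
  "g_kappa \<kappa> p =
     (\<chi> i j. (if i = j then 1 else 0) + (2 * \<kappa> + \<kappa>\<^sup>2 * (p \<bullet> p)) * p $ i * p $ j)"

definition polar :: "real \<times> real \<Rightarrow> real^2" where
  "polar = (\<lambda>(r, \<theta>). vector [r * cos \<theta>, r * sin \<theta>])"

lemma has_derivative_polar:
  "(polar has_derivative
      (\<lambda>(a, b). a *\<^sub>R vector [cos \<theta>, sin \<theta>] + b *\<^sub>R vector [- r * sin \<theta>, r * cos \<theta>])) (at (r, \<theta>))"
proof -
  have *: "polar = (\<lambda>z. (fst z * cos (snd z)) *\<^sub>R axis 1 1 + (fst z * sin (snd z)) *\<^sub>R axis 2 1)"
    by (auto simp: polar_def vec_eq_iff forall_2 axis_def fun_eq_iff)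
  show ?thesis
    unfolding *
    by (auto intro!: derivative_eq_intros
        simp: vec_eq_iff forall_2 axis_def fun_eq_iff algebra_simps split_beta)
qed

lemma metric_inner_g_kappa:
  "metric_inner (g_kappa \<kappa>) p v w = v \<bullet> w + (2 * \<kappa> + \<kappa>\<^sup>2 * (p \<bullet> p)) * (p \<bullet> v) * (p \<bullet> w)"
  by (simp add: metric_inner_def g_kappa_def inner_vec_def matrix_vector_mult_def sum_2
      algebra_simps)

lemma g_kappa_polar:
  "metric_inner (g_kappa \<kappa>) (polar (r, \<theta>))
     (frechet_derivative polar (at (r, \<theta>)) (a, b)) (frechet_derivative polar (at (r, \<theta>)) (a', b'))
   = (1 + \<kappa> * r\<^sup>2)\<^sup>2 * a * a' + r\<^sup>2 * b * b'"
proof -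
  define p where "p = polar (r, \<theta>)"
  define e where "e = (vector [cos \<theta>, sin \<theta>] :: real^2)"
  define f where "f = (vector [- r * sin \<theta>, r * cos \<theta>] :: real^2)"
  have cs: "cos \<theta> * cos \<theta> + sin \<theta> * sin \<theta> = 1"
    using sin_cos_squared_add3 by simp
  have pe: "p = r *\<^sub>R e"
    by (simp add: p_def e_def polar_def vec_eq_iff forall_2)
  have ee: "e \<bullet> e = 1" and ef: "e \<bullet> f = 0" "f \<bullet> e = 0"
    using cs by (simp_all add: e_def f_def inner_vec_def sum_2)
  have "f \<bullet> f = r\<^sup>2 * (cos \<theta> * cos \<theta>) + r\<^sup>2 * (sin \<theta> * sin \<theta>)"
    by (simp add: f_def inner_vec_def sum_2 power2_eq_square)
  then have ff: "f \<bullet> f = r\<^sup>2" by (simp only: cs distrib_left[symmetric] mult_1_right)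
  have D: "frechet_derivative polar (at (r, \<theta>)) (a, b) = a *\<^sub>R e + b *\<^sub>R f" for a b
    using frechet_derivative_at[OF has_derivative_polar[where r = r and \<theta> = \<theta>]]
    by (metis (mono_tags, lifting) e_def f_def case_prod_conv)
  show ?thesis
    unfolding metric_inner_g_kappa D p_def[symmetric]
    by (simp add: pe inner_add_left inner_add_right ee ef ff algebra_simps power2_eq_square)
qed

lemma Ck_on_Suc: "Ck_on (Suc k) U f \<Longrightarrow> Ck_on k U f"
proof (induction k arbitrary: f)
  case 0
  then show ?case
    by (auto intro!: differentiable_imp_continuous_on differentiable_at_imp_differentiable_on)
next
  case (Suc k)
  then show ?case by (metis Ck_on.simps(2))
qed

lemma Ck_on_const: "Ck_on k UNIV (\<lambda>p. c)"
proof (induction k arbitrary: c)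
  case (Suc k)
  have "partial i (\<lambda>p. c) = (\<lambda>p. 0)" for i
    by (simp add: partial_def fun_eq_iff)
  with Suc show ?case by simp
qed simp

lemma Ck_on_coord: "Ck_on k UNIV (\<lambda>p. p $ j)"
proof (cases k)
  case 0
  then show ?thesis by (auto intro!: continuous_intros)
next
  case (Suc k)
  have d: "((\<lambda>p. p $ j) has_derivative (\<lambda>p. p $ j)) (at p)" for p :: "real^2"
    by (rule bounded_linear_imp_has_derivative[OF bounded_linear_vec_nth])
  then have "partial i (\<lambda>p. p $ j) = (\<lambda>p. axis i 1 $ j)" for i
    by (simp add: partial_def fun_eq_iff frechet_derivative_at[OF d, symmetric])
  with Suc d show ?thesis by (auto simp: Ck_on_const differentiable_def)
qed

lemma Ck_on_add: "Ck_on k UNIV f \<Longrightarrow> Ck_on k UNIV h \<Longrightarrow> Ck_on k UNIV (\<lambda>p. f p + h p)"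
proof (induction k arbitrary: f h)
  case 0
  then show ?case by (auto intro!: continuous_intros)
next
  case (Suc k)
  have d: "f differentiable (at p)" "h differentiable (at p)" for p
    using Suc.prems by auto
  have "partial i (\<lambda>p. f p + h p) = (\<lambda>p. partial i f p + partial i h p)" for i
    using frechet_derivative_at[OF has_derivative_add[OF d[unfolded frechet_derivative_works]]]
    by (simp add: partial_def fun_eq_iff)
  with Suc d show ?case by auto
qed

lemma Ck_on_mult: "Ck_on k UNIV f \<Longrightarrow> Ck_on k UNIV h \<Longrightarrow> Ck_on k UNIV (\<lambda>p. f p * h p)"
proof (induction k arbitrary: f h)
  case 0
  then show ?case by (auto intro!: continuous_intros)
next
  case (Suc k)
  have d: "f differentiable (at p)" "h differentiable (at p)" for p
    using Suc.prems by auto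
  have "partial i (\<lambda>p. f p * h p) = (\<lambda>p. f p * partial i h p + partial i f p * h p)" for i
    using frechet_derivative_at[OF has_derivative_mult[OF d[unfolded frechet_derivative_works]]]
    by (simp add: partial_def fun_eq_iff)
  moreover have "Ck_on k UNIV f" "Ck_on k UNIV h"
    using Suc.prems Ck_on_Suc by blast+
  ultimately show ?case
    using Suc d by (auto intro!: Ck_on_add)
qed

lemma riemannian_metric_on_g_kappa:
  assumes "R > 0" "\<kappa> > - 1 / R\<^sup>2"
  shows "riemannian_metric_on (disc R) (g_kappa \<kappa>)"
  unfolding riemannian_metric_on_def
proof (intro conjI ballI allI impI)
  show "\<exists>U. open U \<and> disc R \<subseteq> U \<and> (\<forall>i j. smooth_on U (\<lambda>p. g_kappa \<kappa> p $ i $ j))"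
    by (rule exI[of _ UNIV])
       (simp add: smooth_on_def g_kappa_def inner_vec_def sum_2 Ck_on_add Ck_on_mult Ck_on_const
         Ck_on_coord)
next
  fix p :: "real^2"
  show "transpose (g_kappa \<kappa> p) = g_kappa \<kappa> p"
    by (simp add: transpose_def g_kappa_def vec_eq_iff)
next
  fix p v :: "real^2"
  assume p: "p \<in> disc R" and v: "v \<noteq> 0"
  define s where "s = p \<bullet> p"
  have s: "0 \<le> s" "s \<le> R\<^sup>2"
    using p power_mono[of "norm p" R 2] by (auto simp: s_def power2_norm_eq_inner)
  have "1 + \<kappa> * s > 0"
  proof (cases "\<kappa> \<ge> 0")
    case True
    then show ?thesis using s by (simp add: add_pos_nonneg)
  next
    case False
    then have "\<kappa> * s \<ge> \<kappa> * R\<^sup>2" using s by (intro mult_left_mono_neg) auto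
    moreover have "\<kappa> * R\<^sup>2 > - 1" using assms by (simp add: field_simps)
    ultimately show ?thesis by linarith
  qed
  have cs: "(p \<bullet> v)\<^sup>2 \<le> s * (v \<bullet> v)"
    by (simp add: s_def Cauchy_Schwarz_ineq)
  have vv: "v \<bullet> v > 0" using v by simp
  have eq: "metric_inner (g_kappa \<kappa>) p v v = v \<bullet> v + (2 * \<kappa> + \<kappa>\<^sup>2 * s) * (p \<bullet> v)\<^sup>2"
    by (simp add: metric_inner_g_kappa s_def power2_eq_square)
  show "metric_inner (g_kappa \<kappa>) p v v > 0"
  proof (cases "2 * \<kappa> + \<kappa>\<^sup>2 * s \<ge> 0")
    case True
    then show ?thesis using vv by (simp add: eq add_pos_nonneg)
  next
    case False
    then have "(2 * \<kappa> + \<kappa>\<^sup>2 * s) * (p \<bullet> v)\<^sup>2 \<ge> (2 * \<kappa> + \<kappa>\<^sup>2 * s) * (s * (v \<bullet> v))"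
      using cs by (intro mult_left_mono_neg) auto
    then have "metric_inner (g_kappa \<kappa>) p v v \<ge> (1 + \<kappa> * s)\<^sup>2 * (v \<bullet> v)"
      by (simp add: eq power2_eq_square algebra_simps)
    moreover have "(1 + \<kappa> * s)\<^sup>2 * (v \<bullet> v) > 0"
      using \<open>1 + \<kappa> * s > 0\<close> vv by simp
    ultimately show ?thesis by linarith
  qed
qed

end

theory Submission
  imports Defs
begin

text \<open>
  Write \<open>s = |\<gamma>|\<^sup>2\<close> and \<open>a = 1 + \<kappa>s\<close>. Along a unit speed geodesic the function
  \<open>y = a (\<gamma> \<bullet> \<gamma>')\<close> satisfies \<open>y' = 1/a\<close>, and \<open>s - y\<^sup>2\<close> is a constant \<open>C \<ge> 0\<close> (the square of
  Clairaut's constant). Hence \<open>(1 + \<kappa>C) y + \<kappa>y\<^sup>3/3\<close> equals arc length up to a constant, which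
  bounds the exit times and shows that \<open>y\<close> is injective. The curvature is \<open>K = 2\<kappa>/a\<^sup>3\<close>, and the
  Jacobi equation has the explicit fundamental system \<open>y\<close> (the normal part of the rotation
  field) and \<open>\<kappa>y\<^sup>2 - 1 - \<kappa>C\<close>. A nontrivial solution vanishes at \<open>y = p\<close> and \<open>y = q \<noteq> p\<close> iff
  \<open>\<kappa>(pq + C) = -1\<close>. As \<open>|pq + C| \<le> R\<^sup>2\<close> in the disc, this is impossible if \<open>|\<kappa>|R\<^sup>2 < 1\<close>, while for
  \<open>\<kappa>R\<^sup>2 \<ge> 1\<close> it occurs on a diameter (\<open>C = 0\<close>) at the radius \<open>1/\<surd>\<kappa> \<le> R\<close>.
\<close>

section \<open>Connection and curvature of \<open>g_kappa\<close>\<close>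

text \<open>Where positive, this is the factor by which the metric stretches radial directions, and
  its square is the determinant of the metric.\<close>

definition a_kappa :: "real \<Rightarrow> real^2 \<Rightarrow> real" where
  "a_kappa \<kappa> p = 1 + \<kappa> * (p \<bullet> p)"

lemma matrix_inv_eqI:
  fixes A :: "real^'n^'m"
  assumes "A ** B = mat 1" "B ** A = mat 1"
  shows "matrix_inv A = B"
proof -
  have "A ** matrix_inv A = mat 1 \<and> matrix_inv A ** A = mat 1"
    unfolding matrix_inv_def by (rule someI) (use assms in blast)
  then show ?thesis
    by (metis assms(2) matrix_mul_assoc matrix_mul_lid matrix_mul_rid)
qed

lemma partial_eqI:
  "(f has_derivative f') (at p) \<Longrightarrow> partial i f p = f' (axis i 1)"
  by (simp add: partial_def frechet_derivative_at[symmetric])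

lemma axis_nth_if: "axis i x $ j = (if j = i then x else 0)"
  by (simp add: axis_def)

text \<open>The Gram matrix is a rank one perturbation \<open>1 + f p p^T\<close> of the identity,
  so the Sherman-Morrison formula applies; its denominator \<open>1 + f (p \<bullet> p)\<close> is
  the square of \<open>a_kappa\<close>.\<close>

lemma matrix_inv_g_kappa:
  assumes "a_kappa \<kappa> p \<noteq> 0"
  shows "matrix_inv (g_kappa \<kappa> p) =
    (\<chi> i j. (if i = j then 1 else 0) - (2 * \<kappa> + \<kappa>\<^sup>2 * (p \<bullet> p)) * p $ i * p $ j / (a_kappa \<kappa> p)\<^sup>2)"
    (is "_ = ?B")
proof -
  define x y f where "x = p $ 1" and "y = p $ 2" and "f = 2 * \<kappa> + \<kappa>\<^sup>2 * (p \<bullet> p)"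
  define b where "b = (a_kappa \<kappa> p)\<^sup>2"
  have b: "b = 1 + f * (x * x + y * y)"
    by (simp add: b_def f_def x_def y_def a_kappa_def inner_vec_def sum_2
        power2_eq_square algebra_simps)
  have b0: "b \<noteq> 0"
    using assms by (simp add: b_def)
  have "(g_kappa \<kappa> p) ** ?B = mat 1" "?B ** (g_kappa \<kappa> p) = mat 1"
    unfolding g_kappa_def f_def[symmetric] b_def[symmetric]
    using b0 by (simp_all add: matrix_matrix_mult_def mat_def vec_eq_iff forall_2 sum_2
        x_def[symmetric] y_def[symmetric] divide_simps)
      (simp_all add: b algebra_simps)
  then show ?thesis
    by (rule matrix_inv_eqI)
qed

lemma has_derivative_vec_nth: "((\<lambda>q. q $ i) has_derivative (\<lambda>v. v $ i)) F"
  by (rule bounded_linear_imp_has_derivative[OF bounded_linear_vec_nth])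

lemma partial_g_kappa:
  "partial m (\<lambda>q. g_kappa \<kappa> q $ i $ j) p =
     2 * \<kappa>\<^sup>2 * p $ m * p $ i * p $ j
     + (2 * \<kappa> + \<kappa>\<^sup>2 * (p \<bullet> p)) * ((if i = m then p $ j else 0) + (if j = m then p $ i else 0))"
proof -
  have "((\<lambda>q. g_kappa \<kappa> q $ i $ j) has_derivative
      (\<lambda>v. \<kappa>\<^sup>2 * (2 * (p \<bullet> v)) * p $ i * p $ j
        + (2 * \<kappa> + \<kappa>\<^sup>2 * (p \<bullet> p)) * (v $ i * p $ j + p $ i * v $ j))) (at p)"
    unfolding g_kappa_def
    by (auto intro!: derivative_eq_intros has_derivative_vec_nth
        simp: fun_eq_iff algebra_simps inner_commute)
  from partial_eqI[OF this] show ?thesis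
    by (simp add: inner_axis axis_nth_if algebra_simps)
qed

text \<open>With the upper index lowered, the symbol is \<open>p $ l\<close> times a symmetric form
  in \<open>i\<close> and \<open>j\<close>, and the inverse metric maps \<open>p\<close> to
  \<open>p / a^2\<close>. Hence the Christoffel form always points along \<open>p\<close>.\<close>

lemma christoffel_g_kappa:
  assumes "a_kappa \<kappa> p \<noteq> 0"
  shows "christoffel (g_kappa \<kappa>) k i j p =
    p $ k * (\<kappa>\<^sup>2 * p $ i * p $ j + (if i = j then 2 * \<kappa> + \<kappa>\<^sup>2 * (p \<bullet> p) else 0)) / (a_kappa \<kappa> p)\<^sup>2"
proof -
  define x y f where "x = p $ 1" and "y = p $ 2" and "f = 2 * \<kappa> + \<kappa>\<^sup>2 * (p \<bullet> p)"
  define b where "b = (a_kappa \<kappa> p)\<^sup>2"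
  have b: "b = 1 + f * (x * x + y * y)"
    by (simp add: b_def f_def x_def y_def a_kappa_def inner_vec_def sum_2
        power2_eq_square algebra_simps)
  have b0: "b \<noteq> 0"
    using assms by (simp add: b_def)
  have "\<forall>i j k. christoffel (g_kappa \<kappa>) k i j p =
      p $ k * (\<kappa>\<^sup>2 * p $ i * p $ j + (if i = j then f else 0)) / b"
    unfolding christoffel_def partial_g_kappa matrix_inv_g_kappa[OF assms]
    unfolding f_def[symmetric] b_def[symmetric]
    using b0 by (simp add: forall_2 sum_2 x_def[symmetric] y_def[symmetric] divide_simps)
      (simp add: b algebra_simps)
  then show ?thesis by (simp add: f_def b_def)
qed

lemma christoffel_form_g_kappa:
  assumes "a_kappa \<kappa> p \<noteq> 0"
  shows "christoffel_form (g_kappa \<kappa>) p v w =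
    ((\<kappa>\<^sup>2 * (p \<bullet> v) * (p \<bullet> w) + (2 * \<kappa> + \<kappa>\<^sup>2 * (p \<bullet> p)) * (v \<bullet> w)) / (a_kappa \<kappa> p)\<^sup>2) *\<^sub>R p"
proof -
  define f where "f = 2 * \<kappa> + \<kappa>\<^sup>2 * (p \<bullet> p)"
  define b where "b = (a_kappa \<kappa> p)\<^sup>2"
  have "b \<noteq> 0" using assms by (simp add: b_def)
  then show ?thesis
    unfolding christoffel_form_def christoffel_g_kappa[OF assms] f_def[symmetric] b_def[symmetric]
    by (simp add: vec_eq_iff sum_2 inner_vec_def divide_simps) (simp add: algebra_simps)
qed

text \<open>The closed form of the Christoffel symbols is established only on this set; openness
  allows differentiating it there.\<close>

lemma open_a_kappa: "open {p. a_kappa \<kappa> p \<noteq> 0}"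
  unfolding a_kappa_def by (intro open_Collect_neq continuous_intros)

lemma partial_christoffel_g_kappa:
  assumes "a_kappa \<kappa> p \<noteq> 0"
  defines "f \<equiv> 2 * \<kappa> + \<kappa>\<^sup>2 * (p \<bullet> p)"
  shows "partial m (christoffel (g_kappa \<kappa>) k i j) p =
    ((if k = m then 1 else 0) * (\<kappa>\<^sup>2 * p $ i * p $ j + (if i = j then f else 0))
     + p $ k * \<kappa>\<^sup>2 * ((if i = m then p $ j else 0) + (if j = m then p $ i else 0)
         + (if i = j then 2 * p $ m else 0))) / (a_kappa \<kappa> p)\<^sup>2
     - 4 * \<kappa> * p $ m * p $ k * (\<kappa>\<^sup>2 * p $ i * p $ j + (if i = j then f else 0)) / (a_kappa \<kappa> p) ^ 3"
proof -
  \<comment> \<open>A numerical Kronecker delta in place of the case distinction, so that the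
    numerator is a single polynomial to differentiate.\<close>
  define d where "d = (if i = j then 1 else 0 :: real)"
  define a where "a = 1 + \<kappa> * (p \<bullet> p)"
  have a: "a \<noteq> 0" using assms by (simp add: a_def a_kappa_def)
  let ?h = "\<lambda>q. q $ k * (\<kappa>\<^sup>2 * q $ i * q $ j + d * (2 * \<kappa> + \<kappa>\<^sup>2 * (q \<bullet> q)))"
  let ?D = "\<lambda>v. v $ k * (\<kappa>\<^sup>2 * p $ i * p $ j + d * f)
      + p $ k * \<kappa>\<^sup>2 * (v $ i * p $ j + p $ i * v $ j + d * (2 * (p \<bullet> v)))"
  have h: "(?h has_derivative ?D) (at p)"
    unfolding f_def by (auto intro!: derivative_eq_intros has_derivative_vec_nth
        simp: fun_eq_iff algebra_simps inner_commute)
  have a2: "((\<lambda>q. (1 + \<kappa> * (q \<bullet> q))\<^sup>2) has_derivative (\<lambda>v. 4 * \<kappa> * a * (p \<bullet> v))) (at p)"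
    unfolding a_def by (auto intro!: derivative_eq_intros
        simp: fun_eq_iff algebra_simps inner_commute)
  have quotient: "((\<lambda>q. h q / (1 + \<kappa> * (q \<bullet> q))\<^sup>2) has_derivative
      (\<lambda>v. D v / a\<^sup>2 - 4 * \<kappa> * (p \<bullet> v) * h p / a ^ 3)) (at p)"
    if "(h has_derivative D) (at p)" for h :: "real^2 \<Rightarrow> real" and D
    by (rule has_derivative_eq_rhs, rule has_derivative_divide[OF that a2])
      (use a in \<open>simp_all add: a_def[symmetric] fun_eq_iff field_simps eval_nat_numeral\<close>)
  from quotient[OF h] have "(christoffel (g_kappa \<kappa>) k i j has_derivative
      (\<lambda>v. ?D v / a\<^sup>2 - 4 * \<kappa> * (p \<bullet> v) * ?h p / a ^ 3)) (at p)"
    by (rule has_derivative_transform_within_open[OF _ open_a_kappa[of \<kappa>]])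
      (use assms(1) in \<open>auto simp: christoffel_g_kappa d_def a_kappa_def\<close>)
  note D = this
  show ?thesis
    unfolding partial_eqI[OF D]
    by (simp add: inner_axis axis_nth_if d_def a_def a_kappa_def) (simp add: f_def algebra_simps)
qed

lemma det_g_kappa: "det (g_kappa \<kappa> p) = (a_kappa \<kappa> p)\<^sup>2"
  by (simp add: det_2 g_kappa_def a_kappa_def inner_vec_def sum_2 power2_eq_square algebra_simps)

text \<open>In terms of the radial arc length l, with dl = a dr, the metric is dl^2 + r^2
  d\<theta>^2. So K = - r''/r with r' = 1/a, which gives the formula. The proof computes in
  Cartesian coordinates, which covers the origin as well; clearing denominators leaves a polynomial
  identity.\<close>

lemma gauss_curvature_g_kappa:
  assumes "a_kappa \<kappa> p \<noteq> 0"
  shows "gauss_curvature (g_kappa \<kappa>) p = 2 * \<kappa> / (a_kappa \<kappa> p) ^ 3"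
proof -
  define x y a where "x = p $ 1" and "y = p $ 2" and "a = a_kappa \<kappa> p"
  have a: "a \<noteq> 0" using assms by (simp add: a_def)
  have pp: "p \<bullet> p = x * x + y * y" by (simp add: x_def y_def inner_vec_def sum_2)
  have a_eq: "a = 1 + \<kappa> * (x * x + y * y)" by (simp add: a_def a_kappa_def pp)
  show ?thesis
    unfolding gauss_curvature_def riemann_def det_g_kappa partial_christoffel_g_kappa[OF assms]
      christoffel_g_kappa[OF assms] a_def[symmetric] pp
    using a
    by (simp add: sum_2 g_kappa_def pp x_def[symmetric] y_def[symmetric] divide_simps)
      (simp add: a_eq, algebra)
qed


lemma a_kappa_pos:
  assumes "R > 0" "\<kappa> > - 1 / R\<^sup>2" "p \<in> disc R"
  shows "a_kappa \<kappa> p > 0"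
proof -
  have s: "0 \<le> p \<bullet> p" "p \<bullet> p \<le> R\<^sup>2"
    using assms(3) power_mono[of "norm p" R 2] by (auto simp: power2_norm_eq_inner)
  have k: "\<kappa> * R\<^sup>2 > - 1" using assms(1,2) by (simp add: field_simps)
  show ?thesis
  proof (cases "\<kappa> \<ge> 0")
    case True
    then show ?thesis using s by (simp add: a_kappa_def add_pos_nonneg)
  next
    case False
    then have "\<kappa> * (p \<bullet> p) \<ge> \<kappa> * R\<^sup>2" using s by (intro mult_left_mono_neg) auto
    with k show ?thesis by (simp add: a_kappa_def)
  qed
qed

section \<open>Geodesics in a radial variable and the Jacobi equation\<close>

lemma has_real_derivative_inner:
  assumes "(f has_vector_derivative f') (at t within I)" "(g has_vector_derivative g') (at t within I)"
  shows "((\<lambda>t. f t \<bullet> g t) has_real_derivative (f t \<bullet> g' + f' \<bullet> g t)) (at t within I)"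
  using bounded_bilinear.has_vector_derivative[OF bounded_bilinear_inner assms]
  by (simp add: has_real_derivative_iff_has_vector_derivative)

text \<open>The function \<open>y\<close> is the inner product, in the metric, of the velocity with
  the radial field \<open>p / a\<close>. The covariant derivative of that field is 1/a times the
  identity, whence the derivative of \<open>y\<close>. These two relations are all that the bounds
  on exit times and the exclusion of conjugate points draw from the geodesic equation.\<close>

lemma unit_speed_geodesic_g_kappa_radial:
  assumes geo: "unit_speed_geodesic M (g_kappa \<kappa>) I \<gamma> u"
    and pos: "\<And>p. p \<in> M \<Longrightarrow> a_kappa \<kappa> p > 0"
  shows "\<exists>C y. C \<ge> 0 \<and> (\<forall>t\<in>I. \<gamma> t \<bullet> \<gamma> t = (y t)\<^sup>2 + C \<and>
    (y has_real_derivative 1 / a_kappa \<kappa> (\<gamma> t)) (at t within I))"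
proof -
  define a where "a = (\<lambda>t. a_kappa \<kappa> (\<gamma> t))"
  define y where "y = (\<lambda>t. a t * (\<gamma> t \<bullet> u t))"
  have I: "convex I" using geo by (simp add: unit_speed_geodesic_def is_interval_convex)
  have a: "a t > 0" if "t \<in> I" for t
    using geo pos that by (auto simp: unit_speed_geodesic_def a_def)
  have s': "((\<lambda>t. \<gamma> t \<bullet> \<gamma> t) has_real_derivative 2 * (\<gamma> t \<bullet> u t)) (at t within I)"
    if "t \<in> I" for t
    using has_real_derivative_inner[of \<gamma> "u t" t I \<gamma> "u t"] geo that
    by (simp add: unit_speed_geodesic_def inner_commute)
  have speed: "u t \<bullet> u t + (2 * \<kappa> + \<kappa>\<^sup>2 * (\<gamma> t \<bullet> \<gamma> t)) * (\<gamma> t \<bullet> u t)\<^sup>2 = 1" if "t \<in> I" for t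
    using geo that
    by (simp add: unit_speed_geodesic_def metric_inner_g_kappa power2_eq_square mult.assoc)
  have y': "(y has_real_derivative 1 / a t) (at t within I)" if t: "t \<in> I" for t
  proof -
    define q n s where "q = \<gamma> t \<bullet> u t" and "n = u t \<bullet> u t" and "s = \<gamma> t \<bullet> \<gamma> t"
    have at: "a t = 1 + \<kappa> * s" by (simp add: a_def a_kappa_def s_def)
    have "((\<lambda>t. \<gamma> t \<bullet> u t) has_real_derivative
        \<gamma> t \<bullet> (- christoffel_form (g_kappa \<kappa>) (\<gamma> t) (u t) (u t)) + u t \<bullet> u t) (at t within I)"
      using geo t by (intro has_real_derivative_inner) (auto simp: unit_speed_geodesic_def)
    then have q': "((\<lambda>t. \<gamma> t \<bullet> u t) has_real_derivative
        n - s * (\<kappa>\<^sup>2 * q\<^sup>2 + (2 * \<kappa> + \<kappa>\<^sup>2 * s) * n) / (a t)\<^sup>2) (at t within I)"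
      using a[OF t] by (simp add: christoffel_form_g_kappa a_def q_def n_def s_def power2_eq_square
          algebra_simps)
    have a': "(a has_real_derivative \<kappa> * (2 * q)) (at t within I)"
      unfolding a_def a_kappa_def q_def
      by (rule derivative_eq_intros s'[OF t] refl)+ simp
    have n: "n = 1 - (2 * \<kappa> + \<kappa>\<^sup>2 * s) * q\<^sup>2"
      using speed[OF t] by (simp add: q_def n_def s_def)
    \<comment> \<open>This is the claim a'q + aq' = 1/a multiplied by a^2; after unit speed has
      eliminated \<open>n\<close>, it is a polynomial identity in \<open>\<kappa>\<close>,
      \<open>s\<close> and \<open>q\<close>.\<close>
    have "a t * a t * (2 * \<kappa> * q\<^sup>2 + a t * n) - a t * s * (\<kappa>\<^sup>2 * q\<^sup>2 + (2 * \<kappa> + \<kappa>\<^sup>2 * s) * n) = a t"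
      unfolding at n by (simp add: algebra_simps power2_eq_square)
    then have eq: "2 * \<kappa> * q\<^sup>2 + a t * (n - s * (\<kappa>\<^sup>2 * q\<^sup>2 + (2 * \<kappa> + \<kappa>\<^sup>2 * s) * n) / (a t)\<^sup>2) = 1 / a t"
      using a[OF t] by (simp add: field_simps power2_eq_square)
    show ?thesis
      unfolding y_def eq[symmetric]
      by (rule DERIV_cong[OF DERIV_mult[OF a' q']])
        (simp add: q_def[symmetric] power2_eq_square algebra_simps)
  qed
  have "\<exists>C. \<forall>t\<in>I. \<gamma> t \<bullet> \<gamma> t - (y t)\<^sup>2 = C"
  proof (rule has_field_derivative_zero_constant[OF I])
    fix t assume t: "t \<in> I"
    show "((\<lambda>t. \<gamma> t \<bullet> \<gamma> t - (y t)\<^sup>2) has_real_derivative 0) (at t within I)"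
      by (rule derivative_eq_intros s'[OF t] y'[OF t] refl)+ (use a[OF t] in \<open>simp add: y_def\<close>)
  qed
  then obtain C where C: "\<gamma> t \<bullet> \<gamma> t - (y t)\<^sup>2 = C" if "t \<in> I" for t
    by blast
  \<comment> \<open>With f = 2\<kappa> + \<kappa>^2 s one has y^2 = q^2 + s f q^2, so Cauchy-Schwarz
    and unit speed give y^2 \<le> s (n + f q^2) = s.\<close>
  have "C \<ge> 0" if "t \<in> I" for t
  proof -
    define q n s where "q = \<gamma> t \<bullet> u t" and "n = u t \<bullet> u t" and "s = \<gamma> t \<bullet> \<gamma> t"
    have "q\<^sup>2 \<le> s * n" unfolding q_def n_def s_def by (rule Cauchy_Schwarz_ineq)
    moreover have "s * (n + (2 * \<kappa> + \<kappa>\<^sup>2 * s) * q\<^sup>2) = s * 1"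
      using speed[OF that] by (simp add: q_def n_def s_def)
    moreover have "(y t)\<^sup>2 = q\<^sup>2 + s * ((2 * \<kappa> + \<kappa>\<^sup>2 * s) * q\<^sup>2)"
      by (simp add: y_def a_def a_kappa_def q_def s_def power2_eq_square algebra_simps)
    ultimately show ?thesis
      using C[OF that] unfolding s_def[symmetric] by (simp add: distrib_left)
  qed
  \<comment> \<open>The sign of \<open>C\<close> is known only through a point of \<open>I\<close>;
    on an empty interval \<open>C\<close> is arbitrary and is replaced by 0.\<close>
  then show ?thesis
    using C y' unfolding a_def
    by (intro exI[of _ "if I = {} then 0 else C"] exI[of _ y]) (auto simp: algebra_simps)
qed

text \<open>Separation of variables: the right-hand side is the increment of a primitive of 1 +
  \<kappa>(y^2 + C), which is dt/dy. It bounds elapsed time by the range of \<open>y\<close> and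
  shows that \<open>y\<close> takes no value twice.\<close>

lemma arclength_eq:
  fixes y :: "real \<Rightarrow> real"
  assumes "convex I"
    and y': "\<And>t. t \<in> I \<Longrightarrow> (y has_real_derivative 1 / (1 + \<kappa> * ((y t)\<^sup>2 + C))) (at t within I)"
    and nz: "\<And>t. t \<in> I \<Longrightarrow> 1 + \<kappa> * ((y t)\<^sup>2 + C) \<noteq> 0"
    and t: "t\<^sub>0 \<in> I" "t\<^sub>1 \<in> I"
  shows "t\<^sub>1 - t\<^sub>0 = (1 + \<kappa> * C) * (y t\<^sub>1 - y t\<^sub>0) + \<kappa> / 3 * ((y t\<^sub>1) ^ 3 - (y t\<^sub>0) ^ 3)"
proof -
  have "\<exists>c. \<forall>t\<in>I. (1 + \<kappa> * C) * y t + \<kappa> / 3 * (y t) ^ 3 - t = c"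
  proof (rule has_field_derivative_zero_constant[OF assms(1)])
    fix t assume t: "t \<in> I"
    define a where "a = 1 + \<kappa> * ((y t)\<^sup>2 + C)"
    have "(1 + \<kappa> * C) * (1 / a) + \<kappa> / 3 * (3 * (y t)\<^sup>2 * (1 / a)) - 1 = a / a - 1"
      by (simp add: a_def add_divide_distrib[symmetric]) (simp add: algebra_simps)
    also have "\<dots> = 0" using nz[OF t] by (simp add: a_def)
    finally have eq: "(1 + \<kappa> * C) * (1 / a) + \<kappa> / 3 * (3 * (y t)\<^sup>2 * (1 / a)) - 1 = 0" .
    have yt: "(y has_real_derivative 1 / a) (at t within I)" using y'[OF t] by (simp add: a_def)
    show "((\<lambda>t. (1 + \<kappa> * C) * y t + \<kappa> / 3 * (y t) ^ 3 - t) has_real_derivative 0) (at t within I)"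
      by (rule derivative_eq_intros yt refl)+ (use eq in \<open>simp add: ac_simps\<close>)
  qed
  then obtain c where c: "\<And>t. t \<in> I \<Longrightarrow> (1 + \<kappa> * C) * y t + \<kappa> / 3 * (y t) ^ 3 - t = c"
    by blast
  show ?thesis using c[OF t(1)] c[OF t(2)] by (simp add: algebra_simps)
qed

text \<open>The Wronskians of \<open>j\<close> with the two explicit solutions are constant, and the
  Wronskian of those two solutions is 1, so Cramer's rule expresses \<open>j\<close> through them.
  This replaces an appeal to uniqueness for linear differential equations.\<close>

lemma jacobi_equation_solution:
  fixes y j j' :: "real \<Rightarrow> real" and \<kappa> C :: real
  defines "a \<equiv> \<lambda>t. 1 + \<kappa> * ((y t)\<^sup>2 + C)"
  assumes "convex I"
    and y': "\<And>t. t \<in> I \<Longrightarrow> (y has_real_derivative 1 / a t) (at t within I)"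
    and nz: "\<And>t. t \<in> I \<Longrightarrow> a t \<noteq> 0"
    and j': "\<And>t. t \<in> I \<Longrightarrow> (j has_real_derivative j' t) (at t within I)"
    and j'': "\<And>t. t \<in> I \<Longrightarrow> (j' has_real_derivative - (2 * \<kappa> / (a t) ^ 3) * j t) (at t within I)"
  shows "\<exists>\<alpha> \<beta>. \<forall>t\<in>I. j t = \<alpha> * y t + \<beta> * (\<kappa> * (y t)\<^sup>2 - 1 - \<kappa> * C)"
proof -
  define z where "z = (\<lambda>t. \<kappa> * (y t)\<^sup>2 - 1 - \<kappa> * C)"
  have a': "(a has_real_derivative 2 * \<kappa> * y t / a t) (at t within I)" if "t \<in> I" for t
    unfolding a_def by (auto intro!: derivative_eq_intros y'[unfolded a_def] that)
  have z': "(z has_real_derivative 2 * \<kappa> * y t / a t) (at t within I)" if "t \<in> I" for t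
    unfolding z_def by (auto intro!: derivative_eq_intros y' that)
  have "\<exists>c. \<forall>t\<in>I. j' t * y t - j t * (1 / a t) = c"
  proof (rule has_field_derivative_zero_constant[OF assms(2)])
    fix t assume t: "t \<in> I"
    show "((\<lambda>t. j' t * y t - j t * (1 / a t)) has_real_derivative 0) (at t within I)"
      by (rule derivative_eq_intros y' j' j'' a' nz t refl)+
        (use nz[OF t] in \<open>simp add: field_simps eval_nat_numeral\<close>)
  qed
  then obtain V where V: "\<And>t. t \<in> I \<Longrightarrow> j' t * y t - j t * (1 / a t) = V" by blast
  have "\<exists>c. \<forall>t\<in>I. j' t * z t - j t * (2 * \<kappa> * y t / a t) = c"
  proof (rule has_field_derivative_zero_constant[OF assms(2)])
    fix t assume t: "t \<in> I"
    have az: "z t = 2 * \<kappa> * (y t)\<^sup>2 - a t" by (simp add: z_def a_def algebra_simps)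
    show "((\<lambda>t. j' t * z t - j t * (2 * \<kappa> * y t / a t)) has_real_derivative 0) (at t within I)"
      by (rule derivative_eq_intros y' z' j' j'' a' nz t refl)+
        (use nz[OF t] in \<open>simp add: az field_simps eval_nat_numeral\<close>)
  qed
  then obtain W where W: "\<And>t. t \<in> I \<Longrightarrow> j' t * z t - j t * (2 * \<kappa> * y t / a t) = W" by blast
  have "j t = - W * y t + V * z t" if t: "t \<in> I" for t
  proof -
    \<comment> \<open>Equivalent to y z' - y' z = (2\<kappa>y^2 - z)/a = 1, the Wronskian of the two
      explicit solutions.\<close>
    have az: "z t = 2 * \<kappa> * (y t)\<^sup>2 - a t" by (simp add: z_def a_def algebra_simps)
    show ?thesis
      unfolding V[OF t, symmetric] W[OF t, symmetric] az
      using nz[OF t] by (simp add: field_simps eval_nat_numeral)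
  qed
  then show ?thesis unfolding z_def by blast
qed

section \<open>Convexity of the boundary and bounded exit times\<close>

text \<open>The unit normal is - q/(|q| a), whose scalar factor is constant on circles. In a
  tangential direction its derivative is therefore \<open>- c *\<^sub>R v\<close>, and the
  Christoffel term vanishes by orthogonality. Thus the second fundamental form is \<open>c\<close>
  times the metric on tangent vectors, \<open>c\<close> being the geodesic curvature of the boundary
  circle.\<close>

lemma strictly_convex_boundary_g_kappa:
  assumes "R > 0" "\<kappa> > - 1 / R\<^sup>2"
  shows "strictly_convex_boundary R (g_kappa \<kappa>)"
  unfolding strictly_convex_boundary_def
proof (intro ballI allI impI)
  fix p v :: "real^2"
  assume p: "p \<in> sphere 0 R" and "p \<bullet> v = 0 \<and> v \<noteq> 0"
  then have pv: "p \<bullet> v = 0" and v: "v \<noteq> 0" by auto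
  have np: "norm p = R" using p by simp
  have ap: "a_kappa \<kappa> p > 0" using assms p by (intro a_kappa_pos) auto
  \<comment> \<open>An open neighbourhood of \<open>p\<close> on which the closed form
    \<open>N\<close> of the normal holds, so that it can be differentiated in place of
    \<open>inward_normal\<close>.\<close>
  define S where "S = {q. a_kappa \<kappa> q > 0} \<inter> - {0}"
  have S: "open S" unfolding S_def a_kappa_def
    by (intro open_Int open_Collect_less continuous_intros open_Compl closed_singleton)
  have pS: "p \<in> S" using ap np assms by (auto simp: S_def)
  have N: "inward_normal (g_kappa \<kappa>) q = - (1 / (norm q * a_kappa \<kappa> q)) *\<^sub>R q" if "q \<in> S" for q
  proof -
    define a s where "a = a_kappa \<kappa> q" and "s = q \<bullet> q"
    have a: "a > 0" and s: "s > 0" using that by (auto simp: S_def a_def s_def)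
    have as: "a\<^sup>2 = 1 + (2 * \<kappa> + \<kappa>\<^sup>2 * s) * s"
      by (simp add: a_def s_def a_kappa_def power2_eq_square algebra_simps)
    \<comment> \<open>The position vector \<open>q\<close> is an eigenvector of the Gram matrix at
      \<open>q\<close>, with eigenvalue a^2.\<close>
    have "matrix_inv (g_kappa \<kappa> q) *v q = (1 - (2 * \<kappa> + \<kappa>\<^sup>2 * s) * s / a\<^sup>2) *\<^sub>R q"
      using a unfolding a_def
      by (simp add: matrix_inv_g_kappa)
        (simp add: s_def vec_eq_iff forall_2 matrix_vector_mult_def sum_2 inner_vec_def field_simps)
    also have "1 - (2 * \<kappa> + \<kappa>\<^sup>2 * s) * s / a\<^sup>2 = 1 / a\<^sup>2"
      using a by (simp add: field_simps as[symmetric]) (simp add: as algebra_simps)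
    finally have n: "matrix_inv (g_kappa \<kappa> q) *v q = (1 / a\<^sup>2) *\<^sub>R q" .
    have "metric_inner (g_kappa \<kappa>) q ((1 / a\<^sup>2) *\<^sub>R q) ((1 / a\<^sup>2) *\<^sub>R q)
        = (1 / a\<^sup>2)\<^sup>2 * (s * (1 + (2 * \<kappa> + \<kappa>\<^sup>2 * s) * s))"
      by (simp add: metric_inner_g_kappa s_def[symmetric] power2_eq_square algebra_simps)
    also have "\<dots> = s / a\<^sup>2"
      using a unfolding as[symmetric] by (simp add: power2_eq_square)
    finally have "sqrt (metric_inner (g_kappa \<kappa>) q ((1 / a\<^sup>2) *\<^sub>R q) ((1 / a\<^sup>2) *\<^sub>R q)) = norm q / a"
      using a by (simp add: real_sqrt_divide s_def norm_eq_sqrt_inner)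
    then show ?thesis
      using a by (simp add: inward_normal_def n Let_def a_def[symmetric] power2_eq_square)
  qed
  define c where "c = 1 / (R * a_kappa \<kappa> p)"
  have c: "c > 0" using ap assms by (simp add: c_def)
  have norm': "(norm has_derivative (\<lambda>w. w \<bullet> sgn p)) (at p)"
    using np assms(1) by (intro has_derivative_norm) auto
  define D where "D = (\<lambda>w. (norm p * (2 * \<kappa> * (p \<bullet> w)) + (w \<bullet> sgn p) * (1 + \<kappa> * (p \<bullet> p))) * c\<^sup>2)"
  have "((\<lambda>q. 1 / (norm q * (1 + \<kappa> * (q \<bullet> q)))) has_derivative (\<lambda>w. - D w)) (at p)"
    using ap assms(1) np
    by (auto intro!: derivative_eq_intros norm' simp: D_def c_def a_kappa_def fun_eq_iff
        inner_commute power2_eq_square divide_simps)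
  from has_derivative_minus[OF has_derivative_scaleR[OF this has_derivative_ident]]
  have "(inward_normal (g_kappa \<kappa>) has_derivative
      (\<lambda>w. - ((1 / (norm p * (1 + \<kappa> * (p \<bullet> p)))) *\<^sub>R w + (- D w) *\<^sub>R p))) (at p)"
    by (rule has_derivative_transform_within_open[OF _ S pS]) (simp add: N a_kappa_def)
  then have "frechet_derivative (inward_normal (g_kappa \<kappa>)) (at p) v = - c *\<^sub>R v"
    using pv np
    by (simp add: frechet_derivative_at[symmetric] D_def c_def a_kappa_def sgn_div_norm inner_commute)
  moreover have "christoffel_form (g_kappa \<kappa>) p v (inward_normal (g_kappa \<kappa>) p) = 0"
    using ap pv by (simp add: christoffel_form_g_kappa N[OF pS] inner_commute)
  ultimately show "second_fundamental_form (g_kappa \<kappa>) p v v > 0"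
    using c v pv
    by (simp add: second_fundamental_form_def cov_deriv_def metric_inner_g_kappa)
qed

lemma non_trapping_g_kappa:
  assumes "R > 0" "\<kappa> > - 1 / R\<^sup>2"
  shows "non_trapping (disc R) (g_kappa \<kappa>)"
proof -
  \<comment> \<open>A termwise bound for the right-hand side of \<open>arclength_eq\<close>, from
    |y| \<le> R and 0 \<le> C \<le> R^2.\<close>
  define L where "L = (1 + \<bar>\<kappa>\<bar> * R\<^sup>2) * (2 * R) + \<bar>\<kappa>\<bar> / 3 * (2 * R ^ 3)"
  have "T \<le> L" if "T \<ge> 0" and geo: "unit_speed_geodesic (disc R) (g_kappa \<kappa>) {0..T} \<gamma> u" for T \<gamma> u
  proof -
    obtain C y where C: "C \<ge> 0" and s: "\<And>t. t \<in> {0..T} \<Longrightarrow> \<gamma> t \<bullet> \<gamma> t = (y t)\<^sup>2 + C"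
      and y': "\<And>t. t \<in> {0..T} \<Longrightarrow> (y has_real_derivative 1 / a_kappa \<kappa> (\<gamma> t)) (at t within {0..T})"
      using unit_speed_geodesic_g_kappa_radial[OF geo a_kappa_pos[OF assms]] by blast
    have disc: "\<gamma> t \<in> disc R" if "t \<in> {0..T}" for t
      using geo that by (auto simp: unit_speed_geodesic_def)
    have ak: "a_kappa \<kappa> (\<gamma> t) = 1 + \<kappa> * ((y t)\<^sup>2 + C)" if "t \<in> {0..T}" for t
      using s[OF that] by (simp add: a_kappa_def)
    have sR: "(y t)\<^sup>2 + C \<le> R\<^sup>2" if "t \<in> {0..T}" for t
      using s[OF that] disc[OF that] power_mono[of "norm (\<gamma> t)" R 2]
      by (simp add: power2_norm_eq_inner)
    have yR: "\<bar>y t\<bar> \<le> R" if "t \<in> {0..T}" for t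
      using sR[OF that] C assms(1) abs_le_square_iff[of "y t" R] by simp
    have y3: "\<bar>y t ^ 3\<bar> \<le> R ^ 3" if "t \<in> {0..T}" for t
      using power_mono[OF yR[OF that], of 3] by (simp add: power_abs)
    have T: "0 \<in> {0..T}" "T \<in> {0..T}" using \<open>T \<ge> 0\<close> by auto
    have "T - 0 = (1 + \<kappa> * C) * (y T - y 0) + \<kappa> / 3 * (y T ^ 3 - y 0 ^ 3)"
    proof (rule arclength_eq[OF _ _ _ T])
      show "convex {0..T}" by simp
      show "(y has_real_derivative 1 / (1 + \<kappa> * ((y t)\<^sup>2 + C))) (at t within {0..T})"
        "1 + \<kappa> * ((y t)\<^sup>2 + C) \<noteq> 0" if "t \<in> {0..T}" for t
        using y'[OF that] a_kappa_pos[OF assms disc[OF that]] by (simp_all add: ak[OF that])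
    qed
    also have "\<dots> \<le> \<bar>(1 + \<kappa> * C) * (y T - y 0)\<bar> + \<bar>\<kappa> / 3 * (y T ^ 3 - y 0 ^ 3)\<bar>"
      by linarith
    also have "\<dots> \<le> L"
      unfolding L_def abs_mult
    proof (intro add_mono mult_mono)
      have "C \<le> R\<^sup>2" using sR[OF T(1)] zero_le_power2[of "y 0"] by linarith
      then have "\<bar>\<kappa> * C\<bar> \<le> \<bar>\<kappa>\<bar> * R\<^sup>2"
        using C by (simp add: abs_mult mult_left_mono)
      then show "\<bar>1 + \<kappa> * C\<bar> \<le> 1 + \<bar>\<kappa>\<bar> * R\<^sup>2" by linarith
      show "\<bar>y T - y 0\<bar> \<le> 2 * R" using yR[OF T(1)] yR[OF T(2)] by linarith
      show "\<bar>y T ^ 3 - y 0 ^ 3\<bar> \<le> 2 * R ^ 3" using y3[OF T(1)] y3[OF T(2)] by linarith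
    qed (use assms in auto)
    finally show ?thesis by simp
  qed
  then have "exit_time (disc R) (g_kappa \<kappa>) p v \<le> ereal L" for p v
    unfolding exit_time_def by (intro Sup_least) auto
  then show ?thesis unfolding non_trapping_def by blast
qed

section \<open>Absence and existence of conjugate points\<close>

lemma no_conjugate_points_g_kappa:
  assumes "R > 0" "\<bar>\<kappa>\<bar> * R\<^sup>2 < 1"
  shows "\<not> has_conjugate_points (disc R) (g_kappa \<kappa>)"
proof
  have "- 1 < - \<bar>\<kappa>\<bar> * R\<^sup>2" using assms by simp
  also have "\<dots> \<le> \<kappa> * R\<^sup>2" by (intro mult_right_mono) auto
  finally have k: "\<kappa> > - 1 / R\<^sup>2" using assms by (simp add: field_simps)
  assume "has_conjugate_points (disc R) (g_kappa \<kappa>)"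
  then obtain I \<gamma> u t\<^sub>0 t\<^sub>1 j j' where geo: "unit_speed_geodesic (disc R) (g_kappa \<kappa>) I \<gamma> u"
    and t: "t\<^sub>0 \<in> I" "t\<^sub>1 \<in> I" "t\<^sub>0 < t\<^sub>1"
    and j': "\<And>t. t \<in> I \<Longrightarrow> (j has_real_derivative j' t) (at t within I)"
    and j'': "\<And>t. t \<in> I \<Longrightarrow>
      (j' has_real_derivative - gauss_curvature (g_kappa \<kappa>) (\<gamma> t) * j t) (at t within I)"
    and ne: "\<exists>t\<in>I. j t \<noteq> 0" and j0: "j t\<^sub>0 = 0" "j t\<^sub>1 = 0"
    unfolding has_conjugate_points_def conjugate_along_def jacobi_solution_def by blast
  have I: "convex I" using geo by (simp add: unit_speed_geodesic_def is_interval_convex)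
  obtain C y where C: "C \<ge> 0" and s: "\<And>t. t \<in> I \<Longrightarrow> \<gamma> t \<bullet> \<gamma> t = (y t)\<^sup>2 + C"
    and y': "\<And>t. t \<in> I \<Longrightarrow> (y has_real_derivative 1 / a_kappa \<kappa> (\<gamma> t)) (at t within I)"
    using unit_speed_geodesic_g_kappa_radial[OF geo a_kappa_pos[OF assms(1) k]] by blast
  have disc: "\<gamma> t \<in> disc R" if "t \<in> I" for t
    using geo that by (auto simp: unit_speed_geodesic_def)
  have sR: "(y t)\<^sup>2 + C \<le> R\<^sup>2" if "t \<in> I" for t
    using s[OF that] disc[OF that] power_mono[of "norm (\<gamma> t)" R 2]
    by (simp add: power2_norm_eq_inner)
  have ak: "a_kappa \<kappa> (\<gamma> t) = 1 + \<kappa> * ((y t)\<^sup>2 + C)" if "t \<in> I" for t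
    using s[OF that] by (simp add: a_kappa_def)
  have nz: "1 + \<kappa> * ((y t)\<^sup>2 + C) \<noteq> 0" if "t \<in> I" for t
    using a_kappa_pos[OF assms(1) k disc[OF that]] ak[OF that] by simp
  have y1: "(y has_real_derivative 1 / (1 + \<kappa> * ((y t)\<^sup>2 + C))) (at t within I)" if "t \<in> I" for t
    using y'[OF that] ak[OF that] by simp
  have "(j' has_real_derivative - (2 * \<kappa> / (1 + \<kappa> * ((y t)\<^sup>2 + C)) ^ 3) * j t) (at t within I)"
    if "t \<in> I" for t
    using j''[OF that] nz[OF that] by (simp add: gauss_curvature_g_kappa ak[OF that])
  then obtain \<alpha> \<beta> where j: "\<And>t. t \<in> I \<Longrightarrow> j t = \<alpha> * y t + \<beta> * (\<kappa> * (y t)\<^sup>2 - 1 - \<kappa> * C)"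
    using jacobi_equation_solution[OF I y1 nz j'] by blast
  define p q where "p = y t\<^sub>0" and "q = y t\<^sub>1"
  \<comment> \<open>Equal values of \<open>y\<close> would make the elapsed time
    \<open>t\<^sub>1 - t\<^sub>0\<close> zero.\<close>
  have "p \<noteq> q"
    using arclength_eq[OF I y1 nz t(1,2)] t(3) by (auto simp: p_def q_def)
  have e: "\<alpha> * p + \<beta> * (\<kappa> * p\<^sup>2 - 1 - \<kappa> * C) = 0" "\<alpha> * q + \<beta> * (\<kappa> * q\<^sup>2 - 1 - \<kappa> * C) = 0"
    using j[OF t(1)] j[OF t(2)] j0 by (simp_all add: p_def q_def)
  \<comment> \<open>The average of the bounds p^2 + C \<le> R^2 and q^2 + C \<le> R^2 dominates |pq|
    + C.\<close>
  have "\<kappa> * (p * q + C) + 1 \<noteq> 0"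
  proof -
    have "2 * \<bar>p * q\<bar> \<le> p\<^sup>2 + q\<^sup>2"
      using sum_squares_bound[of "\<bar>p\<bar>" "\<bar>q\<bar>"] by (simp add: abs_mult)
    then have "\<bar>p * q + C\<bar> \<le> R\<^sup>2"
      using sR[OF t(1)] sR[OF t(2)] C unfolding p_def[symmetric] q_def[symmetric] by linarith
    then have "\<bar>\<kappa> * (p * q + C)\<bar> \<le> \<bar>\<kappa>\<bar> * R\<^sup>2"
      by (simp add: abs_mult mult_left_mono)
    then show ?thesis using assms(2) by linarith
  qed
  \<comment> \<open>The factor is the determinant of the linear system \<open>e\<close> in
    \<open>\<alpha>\<close> and \<open>\<beta>\<close>, so this is Cramer's rule.\<close>
  moreover have "\<beta> * ((q - p) * (\<kappa> * (p * q + C) + 1)) = 0"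
    "\<alpha> * ((q - p) * (\<kappa> * (p * q + C) + 1)) = 0"
    using e by algebra+
  ultimately have "\<alpha> = 0" "\<beta> = 0" using \<open>p \<noteq> q\<close> by auto
  then show False using ne j by simp
qed

text \<open>A diameter is parametrised explicitly by arc length, with no existence theorem for
  geodesics. Its points at radius \<open>\<rho>\<close>, on either side of the origin, are
  conjugate; \<open>\<rho> = R\<close> is possible, and then they lie on the boundary.\<close>

lemma has_conjugate_points_g_kappa:
  assumes "R > 0" "\<kappa> \<ge> 1 / R\<^sup>2"
  shows "has_conjugate_points (disc R) (g_kappa \<kappa>)"
proof -
  have k: "\<kappa> > 0" using assms by (meson less_le_trans zero_less_divide_1_iff zero_less_power)
  define \<rho> where "\<rho> = 1 / sqrt \<kappa>"
  have \<rho>: "\<rho> > 0" "\<kappa> * \<rho>\<^sup>2 = 1" using k by (simp_all add: \<rho>_def power_divide)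
  have "\<kappa> * \<rho>\<^sup>2 \<le> \<kappa> * R\<^sup>2"
    using assms \<rho>(2) by (simp add: field_simps)
  then have "\<rho>\<^sup>2 \<le> R\<^sup>2" using k by simp
  then have \<rho>R: "\<rho> \<le> R" using assms(1) power2_le_imp_le by fastforce
  \<comment> \<open>Signed arc length from the origin along the diameter: the primitive of 1 +
    \<kappa>x^2, as in \<open>arclength_eq\<close> with C = 0. It is injective on the whole line, so
    \<open>inv\<close> yields the signed radius \<open>y\<close> as a function of arc
    length.\<close>
  define F where "F = (\<lambda>x. x + \<kappa> / 3 * x ^ 3)"
  define y where "y = inv F"
  have F': "(F has_real_derivative 1 + \<kappa> * x\<^sup>2) (at x)" for x
    unfolding F_def by (auto intro!: derivative_eq_intros)
  have pos: "1 + \<kappa> * x\<^sup>2 > 0" for x using k by (simp add: add_pos_nonneg)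
  have mono: "F x < F x'" if "x < x'" for x x'
    using DERIV_pos_imp_increasing[OF that] F' pos by blast
  then have "inj F" by (intro linorder_injI) (metis less_irrefl)
  then have yF: "y (F x) = x" for x by (simp add: y_def)
  have contF: "continuous_on S F" for S
    unfolding F_def by (intro continuous_intros)
  have y': "(y has_real_derivative 1 / (1 + \<kappa> * x\<^sup>2)) (at (F x))" for x
  proof -
    have "(y has_derivative (*) (1 / (1 + \<kappa> * x\<^sup>2))) (at (F x))"
    proof (rule has_derivative_inverse_strong[of UNIV x F])
      show "(F has_derivative (*) (1 + \<kappa> * x\<^sup>2)) (at x)"
        using F' by (simp add: has_field_derivative_def)
      show "(*) (1 + \<kappa> * x\<^sup>2) \<circ> (*) (1 / (1 + \<kappa> * x\<^sup>2)) = id"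
        using pos[of x] by (simp add: fun_eq_iff)
    qed (auto simp: yF contF)
    then show ?thesis by (simp add: has_field_derivative_def)
  qed
  \<comment> \<open>Exactly the segment between the two conjugate points, which stays in the disc
    since \<open>\<rho> \<le> R\<close>.\<close>
  define I where "I = F ` {- \<rho>..\<rho>}"
  have I: "is_interval I"
    unfolding I_def is_interval_connected_1 by (intro connected_continuous_image contF) simp
  have yI: "\<kappa> * (y t)\<^sup>2 \<le> 1" "\<bar>y t\<bar> \<le> \<rho>"
      "(y has_real_derivative 1 / (1 + \<kappa> * (y t)\<^sup>2)) (at t within I)" if t: "t \<in> I" for t
  proof -
    obtain x where x: "t = F x" "\<bar>x\<bar> \<le> \<rho>" using t by (auto simp: I_def)
    show "\<bar>y t\<bar> \<le> \<rho>" using x by (simp add: yF)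
    then have "(y t)\<^sup>2 \<le> \<rho>\<^sup>2" using \<rho>(1) abs_le_square_iff[of "y t" \<rho>] by simp
    then show "\<kappa> * (y t)\<^sup>2 \<le> 1" using k \<rho>(2) by (metis mult_left_mono less_imp_le)
    show "(y has_real_derivative 1 / (1 + \<kappa> * (y t)\<^sup>2)) (at t within I)"
      using has_field_derivative_at_within[OF y'[of x]] by (simp add: x yF)
  qed
  define e where "e = (axis 1 1 :: real^2)"
  define \<gamma> where "\<gamma> = (\<lambda>t. y t *\<^sub>R e)"
  define u where "u = (\<lambda>t. (1 / (1 + \<kappa> * (y t)\<^sup>2)) *\<^sub>R e)"
  have ee: "e \<bullet> e = 1" by (simp add: e_def inner_axis_axis)
  have ak: "a_kappa \<kappa> (\<gamma> t) = 1 + \<kappa> * (y t)\<^sup>2" for t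
    by (simp add: a_kappa_def \<gamma>_def ee power2_eq_square)
  \<comment> \<open>Serves twice: for the acceleration of the diameter and for the second derivative
    of the Jacobi field.\<close>
  have v': "((\<lambda>t. 1 / (1 + \<kappa> * (y t)\<^sup>2)) has_real_derivative
      - (2 * \<kappa> * y t / (1 + \<kappa> * (y t)\<^sup>2) ^ 3)) (at t within I)" if "t \<in> I" for t
    using pos[of "y t"]
    by (auto intro!: derivative_eq_intros yI(3) that simp: divide_simps eval_nat_numeral)
  have "unit_speed_geodesic (disc R) (g_kappa \<kappa>) I \<gamma> u"
    unfolding unit_speed_geodesic_def
  proof (intro conjI ballI I)
    fix t assume t: "t \<in> I"
    define a where "a = 1 + \<kappa> * (y t)\<^sup>2"
    have a: "a > 0" using pos by (simp add: a_def)
    have gu: "\<gamma> t = y t *\<^sub>R e" "u t = (1 / a) *\<^sub>R e" by (simp_all add: \<gamma>_def u_def a_def)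
    show "\<gamma> t \<in> disc R" using yI(2)[OF t] \<rho>R by (simp add: \<gamma>_def e_def)
    show "(\<gamma> has_vector_derivative u t) (at t within I)"
      unfolding \<gamma>_def u_def using has_vector_derivative_scaleR[OF yI(3)[OF t] has_vector_derivative_const]
      by simp
    have "christoffel_form (g_kappa \<kappa>) (\<gamma> t) (u t) (u t) =
        ((\<kappa>\<^sup>2 * (y t / a)\<^sup>2 + (2 * \<kappa> + \<kappa>\<^sup>2 * (y t)\<^sup>2) * (1 / a)\<^sup>2) / a\<^sup>2 * y t) *\<^sub>R e"
      using a christoffel_form_g_kappa[of \<kappa> "\<gamma> t" "u t" "u t"] unfolding ak a_def[symmetric]
      by (simp add: gu ee power2_eq_square mult.assoc)
    also have "(\<kappa>\<^sup>2 * (y t / a)\<^sup>2 + (2 * \<kappa> + \<kappa>\<^sup>2 * (y t)\<^sup>2) * (1 / a)\<^sup>2) / a\<^sup>2 * y t =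
        (\<kappa>\<^sup>2 * (y t)\<^sup>2 + (2 * \<kappa> + \<kappa>\<^sup>2 * (y t)\<^sup>2)) / a ^ 4 * y t"
      by (simp add: power_divide add_divide_distrib power4_eq_xxxx power2_eq_square mult.assoc)
    also have "\<kappa>\<^sup>2 * (y t)\<^sup>2 + (2 * \<kappa> + \<kappa>\<^sup>2 * (y t)\<^sup>2) = 2 * \<kappa> * a"
      by (simp add: a_def power2_eq_square algebra_simps)
    also have "2 * \<kappa> * a / a ^ 4 * y t = 2 * \<kappa> * y t / a ^ 3"
      using a by (simp add: eval_nat_numeral)
    finally show "(u has_vector_derivative - christoffel_form (g_kappa \<kappa>) (\<gamma> t) (u t) (u t)) (at t within I)"
      using has_vector_derivative_scaleR[OF v'[OF t] has_vector_derivative_const[of e]]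
      by (simp add: u_def a_def)
    have "metric_inner (g_kappa \<kappa>) (\<gamma> t) (u t) (u t) =
        (1 + (2 * \<kappa> + \<kappa>\<^sup>2 * (y t)\<^sup>2) * (y t)\<^sup>2) / a\<^sup>2"
      by (simp add: metric_inner_g_kappa gu ee power2_eq_square add_divide_distrib)
    also have "1 + (2 * \<kappa> + \<kappa>\<^sup>2 * (y t)\<^sup>2) * (y t)\<^sup>2 = a\<^sup>2"
      by (simp add: a_def power2_eq_square algebra_simps)
    finally show "metric_inner (g_kappa \<kappa>) (\<gamma> t) (u t) (u t) = 1" using a by simp
  qed
  moreover have "conjugate_along (g_kappa \<kappa>) I \<gamma> (F (- \<rho>)) (F \<rho>)"
    unfolding conjugate_along_def
  proof (intro exI conjI)
    \<comment> \<open>The second explicit solution with C = 0; it vanishes where y = \<rho> and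
      where y = - \<rho>.\<close>
    show "jacobi_solution (g_kappa \<kappa>) I \<gamma> (\<lambda>t. \<kappa> * (y t)\<^sup>2 - 1)"
      unfolding jacobi_solution_def
    proof (intro exI ballI conjI)
      fix t assume t: "t \<in> I"
      show "((\<lambda>t. \<kappa> * (y t)\<^sup>2 - 1) has_real_derivative
          2 * \<kappa> * y t * (1 / (1 + \<kappa> * (y t)\<^sup>2))) (at t within I)"
        by (auto intro!: derivative_eq_intros yI(3) t)
      show "((\<lambda>t. 2 * \<kappa> * y t * (1 / (1 + \<kappa> * (y t)\<^sup>2))) has_real_derivative
          - gauss_curvature (g_kappa \<kappa>) (\<gamma> t) * (\<kappa> * (y t)\<^sup>2 - 1)) (at t within I)"
      proof -
        define a where "a = 1 + \<kappa> * (y t)\<^sup>2"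
        have a: "a > 0" using pos by (simp add: a_def)
        have K: "gauss_curvature (g_kappa \<kappa>) (\<gamma> t) = 2 * \<kappa> / a ^ 3"
          using a by (simp add: gauss_curvature_g_kappa ak a_def)
        have ya: "\<kappa> * (y t)\<^sup>2 = a - 1" by (simp add: a_def)
        have "2 * \<kappa> * y t * - (2 * \<kappa> * y t / a ^ 3) + 2 * \<kappa> * (1 / a) * (1 / a) =
            2 * \<kappa> * (a - 2 * (\<kappa> * (y t)\<^sup>2)) / a ^ 3"
          using a by (simp add: field_simps eval_nat_numeral)
        also have "\<dots> = - gauss_curvature (g_kappa \<kappa>) (\<gamma> t) * (\<kappa> * (y t)\<^sup>2 - 1)"
          unfolding K ya using a by (simp add: field_simps)
        finally show ?thesis
          unfolding a_def
          by (rule DERIV_cong[rotated])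
            (rule DERIV_mult'[OF DERIV_cmult[OF yI(3)[OF t]] v'[OF t]])
      qed
    qed
    \<comment> \<open>At the centre of the disc, where y = 0, the field equals -1.\<close>
    show "\<exists>t\<in>I. \<kappa> * (y t)\<^sup>2 - 1 \<noteq> 0"
      using \<rho>(1) by (intro bexI[of _ "F 0"]) (auto simp: I_def yF)
  qed (simp_all add: yF \<rho>)
  moreover have "F (- \<rho>) \<in> I" "F \<rho> \<in> I" "F (- \<rho>) < F \<rho>"
    using \<rho>(1) mono by (auto simp: I_def)
  ultimately show ?thesis unfolding has_conjugate_points_def by blast
qed

theorem corollary3:
  fixes R \<kappa> :: real
  assumes "R > 0" and "\<kappa> > - 1 / R\<^sup>2"
  shows "(\<bar>\<kappa>\<bar> * R\<^sup>2 < 1 \<longrightarrow> simple_disc R (g_kappa \<kappa>)) \<and>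
         (\<kappa> \<ge> 1 / R\<^sup>2 \<longrightarrow> has_conjugate_points (disc R) (g_kappa \<kappa>))"
  using assms
  by (simp add: simple_disc_def riemannian_metric_on_g_kappa strictly_convex_boundary_g_kappa
      non_trapping_g_kappa no_conjugate_points_g_kappa has_conjugate_points_g_kappa)

end
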